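(* Let $E$ and $F$ be Banach lattices, let $T:E\to F$ be a continuous operator, let $A$ be a (norm) bounded solid subset of $E$, and let $(\rho_\gamma)_{\gamma\in\Gamma}$ be a family of norm continuous Riesz pseudonorms on $F$. Suppose that $\rho_\gamma(Tx_n)\to 0$ for every disjoint sequence $(x_n)\subset A$ and every $\gamma\in\Gamma$. Then for each $\epsilon>0$ and each $\gamma\in\Gamma$ there exists some $u\in E_+$ lying in the ideal generated by $A$ such that $\rho_\gamma\big(T((|x|-u)^+)\big)<\epsilon$ holds for all $x\in A$.
   Context: Operators are linear; a continuous operator between Banach lattices is a norm-continuous (bounded) linear operator. $E_+=\{x\in E:x\ge 0\}$; $x^+=x\vee 0$. A set $A\subset E$ is solid if $|x|\le|y|$ and $y\in A$ imply $x\in A$. A sequence $(x_n)$ is disjoint if $|x_n|\wedge|x_m|=0$ for $n\ne m$. A Riesz pseudonorm on a Riesz space $F$ is a function $\rho:F\to\mathbb{R}$ such that: (1) $\rho(x)\ge 0$ for all $x\in F$; (2) $\rho(x+y)\le\rho(x)+\rho(y)$ for all $x,y\in F$; (3) $\rho(\lambda_n x)\to 0$ as $\lambda_n\to 0$ in $\mathbb{R}$, for all $x\in F$; (4) $\rho(x)\le\rho(y)$ whenever $|x|\le|y|$ in $F$. *)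

theory Defs
  imports "HOL-Analysis.Analysis" "HOL-Library.Lattice_Algebras"
begin

text \<open>
  The modulus \<open>\<bar>x\<bar>\<close> is \<open>sup x (- x)\<close> (axiom of the class
  \<open>lattice_ab_group_add_abs\<close>) and the positive part \<open>x \<or> 0\<close> is \<open>pprt x = sup x 0\<close>,
  both from \<open>HOL-Library.Lattice_Algebras\<close>.
\<close>

class riesz_space = ordered_real_vector + lattice_ab_group_add_abs

class banach_lattice = riesz_space + banach +
  assumes lattice_norm: "\<bar>x\<bar> \<le> \<bar>y\<bar> \<Longrightarrow> norm x \<le> norm y"

instance real :: riesz_space ..

instance real :: banach_lattice
  by standard simp

definition solid :: "'a::riesz_space set \<Rightarrow> bool"
  where "solid A \<longleftrightarrow> (\<forall>x y. \<bar>x\<bar> \<le> \<bar>y\<bar> \<and> y \<in> A \<longrightarrow> x \<in> A)"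

text \<open>
  An order ideal is a solid linear subspace; the ideal generated by \<open>A\<close> is the
  smallest one containing \<open>A\<close>, written \<open>order_ideal hull A\<close>.
\<close>

definition order_ideal :: "'a::riesz_space set \<Rightarrow> bool"
  where "order_ideal I \<longleftrightarrow> subspace I \<and> solid I"

lemma order_ideal_hull: "order_ideal (order_ideal hull A)"
  by (rule hull_in) (auto simp: order_ideal_def solid_def intro!: subspace_Inter)

definition disjoint_seq :: "(nat \<Rightarrow> 'a::riesz_space) \<Rightarrow> bool"
  where "disjoint_seq x \<longleftrightarrow> (\<forall>n m. n \<noteq> m \<longrightarrow> inf \<bar>x n\<bar> \<bar>x m\<bar> = 0)"

definition riesz_pseudonorm :: "('a::riesz_space \<Rightarrow> real) \<Rightarrow> bool"
  where "riesz_pseudonorm \<rho> \<longleftrightarrow>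
    (\<forall>x. \<rho> x \<ge> 0) \<and>
    (\<forall>x y. \<rho> (x + y) \<le> \<rho> x + \<rho> y) \<and>
    (\<forall>x. \<forall>l :: nat \<Rightarrow> real. l \<longlonglongrightarrow> 0 \<longrightarrow> (\<lambda>n. \<rho> (l n *\<^sub>R x)) \<longlonglongrightarrow> 0) \<and>
    (\<forall>x y. \<bar>x\<bar> \<le> \<bar>y\<bar> \<longrightarrow> \<rho> x \<le> \<rho> y)"

end

theory Submission
  imports Defs
begin

text \<open>
  The proof disjointifies a would-be counterexample. If no \<open>u\<close> works for \<open>\<epsilon>\<close> and \<open>\<rho>\<close>,
  then every positive \<open>u\<close> in the ideal of \<open>A\<close> is exceeded by some \<open>x \<in> A\<close> in the sense that
  \<open>\<rho> (T (\<bar>x\<bar> - u)\<^sup>+) \<ge> \<epsilon>\<close>. Feeding back large multiples of what has been chosen so far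
  gives \<open>x\<^sub>n \<in> A\<close> such that \<open>w\<^sub>n = (\<bar>x\<^sub>n\<bar> - 4\<^sup>n \<Sum>\<^sub>i\<^sub><\<^sub>n \<bar>x\<^sub>i\<bar>)\<^sup>+\<close> satisfies
  \<open>\<rho> (T w\<^sub>n) \<ge> \<epsilon>\<close>. Thus \<open>w\<^sub>n\<close> lives where \<open>x\<^sub>n\<close> is much larger than its predecessors.
  To make it live also where \<open>x\<^sub>n\<close> is not negligible against its successors, subtract
  a further \<open>2\<^sup>-\<^sup>n y\<close>, where \<open>y = \<Sum>\<^sub>k 2\<^sup>-\<^sup>k \<bar>x\<^sub>k\<bar>\<close> exists because \<open>A\<close> is bounded and \<open>E\<close> is
  complete. The resulting \<open>v\<^sub>n = (\<bar>x\<^sub>n\<bar> - 4\<^sup>n \<Sum>\<^sub>i\<^sub><\<^sub>n \<bar>x\<^sub>i\<bar> - 2\<^sup>-\<^sup>n y)\<^sup>+\<close> are pairwise disjoint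
  (\<open>disjoint_seq_truncations\<close>) and belong to \<open>A\<close> by solidity,
  so \<open>\<rho> (T v\<^sub>n) \<rightarrow> 0\<close>. But truncation is nonexpansive (\<open>norm_pprt_diff_truncation_le\<close>), so
  \<open>\<parallel>w\<^sub>n - v\<^sub>n\<parallel> \<le> 2\<^sup>-\<^sup>n \<parallel>y\<parallel>\<close>, and continuity of \<open>T\<close> and \<open>\<rho>\<close> forces \<open>\<rho> (T w\<^sub>n) \<rightarrow> 0\<close>,
  a contradiction.
\<close>

lemma norm_abs_banach_lattice: "norm \<bar>x\<bar> = norm x" for x :: "'a::banach_lattice"
  by (intro antisym lattice_norm) simp_all

text \<open>
  The positive cone is norm closed: if \<open>z k \<ge> 0\<close>, then \<open>(- l)\<^sup>+ \<le> \<bar>z k - l\<bar>\<close>, so the norm of the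
  negative part of the limit is at most the norm distance from \<open>z k\<close> to \<open>l\<close>.
\<close>
lemma banach_lattice_lim_nonneg:
  fixes z :: "nat \<Rightarrow> 'a::banach_lattice"
  assumes lim: "z \<longlonglongrightarrow> l" and nonneg: "\<And>k. N \<le> k \<Longrightarrow> 0 \<le> z k"
  shows "0 \<le> l"
proof -
  have "norm (pprt (- l)) \<le> norm (z k - l)" if "N \<le> k" for k
  proof (rule lattice_norm)
    have "- l \<le> z k - l"
      using nonneg[OF that] by simp
    also have "\<dots> \<le> \<bar>z k - l\<bar>" by (rule abs_ge_self)
    finally show "\<bar>pprt (- l)\<bar> \<le> \<bar>z k - l\<bar>"
      by (simp add: pprt_def)
  qed
  moreover have "(\<lambda>k. norm (z k - l)) \<longlonglongrightarrow> 0"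
    using lim by (simp add: LIM_zero tendsto_norm_zero)
  ultimately have "norm (pprt (- l)) \<le> 0"
    by (intro LIMSEQ_le_const) auto
  then have "pprt (- l) = 0" by simp
  moreover have "- l \<le> pprt (- l)" by (simp add: pprt_def)
  ultimately show ?thesis by simp
qed

lemma suminf_ge_term:
  fixes f :: "nat \<Rightarrow> 'a::banach_lattice"
  assumes "summable f" "\<And>k. 0 \<le> f k"
  shows "f m \<le> suminf f"
proof -
  have "(\<lambda>n. sum f {..<n} - f m) \<longlonglongrightarrow> suminf f - f m"
    by (intro tendsto_intros summable_LIMSEQ assms)
  then have "0 \<le> suminf f - f m"
  proof (rule banach_lattice_lim_nonneg[where N = "Suc m"])
    fix n assume "Suc m \<le> n"
    then have "sum f {m} \<le> sum f {..<n}"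
      by (intro sum_mono2) (auto simp: assms)
    then show "0 \<le> sum f {..<n} - f m" by simp
  qed
  then show ?thesis by simp
qed

lemma inf_pprt_pprt_uminus: "inf (pprt d) (pprt (- d)) = 0"
  for d :: "'a::lattice_ab_group_add"
proof -
  have "pprt d = d + pprt (- d)"
    by (metis add_diff_cancel_right' diff_conv_add_uminus pprt_neg prts)
  then have "inf (pprt d) (pprt (- d)) = inf (d + pprt (- d)) (0 + pprt (- d))"
    by simp
  also have "\<dots> = inf d 0 + pprt (- d)"
    by (rule add_inf_distrib_right[symmetric])
  also have "\<dots> = 0"
    by (simp only: pprt_neg nprt_def right_minus)
  finally show ?thesis .
qed

text \<open>
  Where \<open>a > c\<inverse> b\<close> one has \<open>b < c a\<close>, so the two truncations live on complementary parts.
  Formally, since \<open>c \<ge> 1\<close>, the first is dominated by \<open>(c a - b)\<^sup>+\<close> while the second is the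
  negative part of the same element \<open>c a - b\<close>.
\<close>
lemma disjoint_pprt_diff_truncations:
  fixes a b :: "'a::riesz_space"
  assumes "1 \<le> c"
  shows "inf (pprt (a - inverse c *\<^sub>R b)) (pprt (b - c *\<^sub>R a)) = 0"
proof (rule antisym)
  let ?p = "pprt (a - inverse c *\<^sub>R b)" and ?d = "c *\<^sub>R a - b"
  have "inverse c *\<^sub>R ?d \<le> inverse c *\<^sub>R pprt ?d"
    using assms by (intro scaleR_left_mono) (auto simp: pprt_def)
  moreover have "inverse c *\<^sub>R pprt ?d \<le> 1 *\<^sub>R pprt ?d"
    using assms by (intro scaleR_right_mono) (auto simp: inverse_le_1_iff)
  moreover have "inverse c *\<^sub>R ?d = a - inverse c *\<^sub>R b"
    using assms by (simp add: scaleR_diff_right)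
  ultimately have "?p \<le> pprt ?d"
    by (simp add: pprt_def)
  then have "inf ?p (pprt (- ?d)) \<le> inf (pprt ?d) (pprt (- ?d))"
    by (rule inf_mono) (rule order_refl)
  then show "inf ?p (pprt (b - c *\<^sub>R a)) \<le> 0"
    unfolding inf_pprt_pprt_uminus unfolding minus_diff_eq .
qed (simp add: pprt_def)

lemma norm_pprt_diff_truncation_le:
  fixes a y :: "'a::banach_lattice"
  assumes "0 \<le> y"
  shows "norm (pprt a - pprt (a - y)) \<le> norm y"
proof (rule lattice_norm)
  have "a - y \<le> a" using assms by simp
  then have "0 \<le> pprt a - pprt (a - y)"
    by (simp add: pprt_mono)
  moreover have "pprt a \<le> pprt (a - y) + y"
  proof -
    have "a - y \<le> pprt (a - y)" "0 \<le> pprt (a - y)" by (simp_all add: pprt_def)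
    then have "a \<le> pprt (a - y) + y" "0 \<le> pprt (a - y) + y"
      using assms by (simp_all add: diff_le_eq)
    then show ?thesis by (simp add: pprt_def)
  qed
  then have "pprt a - pprt (a - y) \<le> y"
    by (simp add: diff_le_eq add.commute)
  ultimately show "\<bar>pprt a - pprt (a - y)\<bar> \<le> \<bar>y\<bar>"
    using assms by (simp add: abs_of_nonneg)
qed

lemma riesz_pseudonorm_zero:
  assumes "riesz_pseudonorm \<rho>"
  shows "\<rho> 0 = 0"
proof -
  have "(\<lambda>n. \<rho> (0 *\<^sub>R 0)) \<longlonglongrightarrow> 0"
    using assms tendsto_const[of "0::real" sequentially]
    unfolding riesz_pseudonorm_def by blast
  then show ?thesis
    by (simp add: LIMSEQ_const_iff)
qed

text \<open>
  For \<open>n < m\<close>, the term with index \<open>m\<close> is cut down by at least \<open>4\<^sup>m a n\<close>, because \<open>s m\<close>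
  dominates \<open>a n\<close>, and the term with index \<open>n\<close> by at least \<open>2\<^sup>-\<^sup>n 2\<^sup>-\<^sup>m a m \<ge> 4\<^sup>-\<^sup>m a m\<close>, because
  \<open>y\<close> dominates \<open>2\<^sup>-\<^sup>m a m\<close>. What is left of the two is disjoint by
  \<open>disjoint_pprt_diff_truncations\<close> with \<open>c = 4\<^sup>m\<close>.
\<close>
lemma disjoint_seq_truncations:
  fixes a s :: "nat \<Rightarrow> 'a::riesz_space"
  assumes a: "\<And>n. 0 \<le> a n" and s: "\<And>n. 0 \<le> s n" "\<And>n m. n < m \<Longrightarrow> a n \<le> s m"
    and y: "\<And>n. (1/2)^n *\<^sub>R a n \<le> y"
  shows "disjoint_seq (\<lambda>n. pprt (a n - 4^n *\<^sub>R s n - (1/2)^n *\<^sub>R y))"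
proof -
  let ?v = "\<lambda>n. pprt (a n - 4^n *\<^sub>R s n - (1/2)^n *\<^sub>R y)"
  have y0: "0 \<le> y"
    using y[of 0] a[of 0] by simp
  have disj: "inf (?v n) (?v m) = 0" if "n < m" for n m
  proof (rule antisym)
    have "inverse (4^m) \<le> (1/2)^n * (1/2::real)^m"
    proof -
      have "inverse (4^m) = (1/2)^m * (1/2::real)^m"
        by (simp add: power_mult_distrib[symmetric] power_inverse[symmetric])
      also have "\<dots> \<le> (1/2)^n * (1/2::real)^m"
        using that by (intro mult_right_mono power_decreasing) auto
      finally show ?thesis .
    qed
    then have "inverse (4^m) *\<^sub>R a m \<le> ((1/2)^n * (1/2)^m) *\<^sub>R a m"
      using a by (intro scaleR_right_mono)
    also have "\<dots> \<le> (1/2)^n *\<^sub>R y"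
      using scaleR_left_mono[OF y[of m], of "(1/2)^n"] by simp
    finally have "inverse (4^m) *\<^sub>R a m \<le> 4^n *\<^sub>R s n + (1/2)^n *\<^sub>R y"
      using s(1)[of n] by (simp add: add_increasing scaleR_nonneg_nonneg)
    then have vn: "?v n \<le> pprt (a n - inverse (4^m) *\<^sub>R a m)"
      unfolding diff_diff_eq by (intro pprt_mono diff_left_mono)
    have "4^m *\<^sub>R a n \<le> 4^m *\<^sub>R s m + (1/2)^m *\<^sub>R y"
      using scaleR_left_mono[OF s(2)[OF that], of "4^m"] y0
      by (simp add: add_increasing2 scaleR_nonneg_nonneg)
    then have vm: "?v m \<le> pprt (a m - 4^m *\<^sub>R a n)"
      unfolding diff_diff_eq by (intro pprt_mono diff_left_mono)
    show "inf (?v n) (?v m) \<le> 0"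
      using inf_mono[OF vn vm] disjoint_pprt_diff_truncations[of "4^m" "a n" "a m"] by simp
  qed simp
  show ?thesis
    unfolding disjoint_seq_def
  proof (intro allI impI)
    fix n m :: nat assume "n \<noteq> m"
    then consider "n < m" | "m < n" by linarith
    then show "inf \<bar>?v n\<bar> \<bar>?v m\<bar> = 0"
      using disj[of n m] disj[of m n]
      by cases (simp_all add: abs_of_nonneg inf_commute[of "?v n"])
  qed
qed

theorem theorem2p2:
  fixes T :: "'a::banach_lattice \<Rightarrow> 'b::banach_lattice"
    and A :: "'a set"
    and \<rho> :: "'i \<Rightarrow> 'b \<Rightarrow> real"
    and \<Gamma> :: "'i set"
  assumes "bounded_linear T"
    and "bounded A" and "solid A"
    and "\<And>\<gamma>. \<gamma> \<in> \<Gamma> \<Longrightarrow> riesz_pseudonorm (\<rho> \<gamma>)"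
    and "\<And>\<gamma>. \<gamma> \<in> \<Gamma> \<Longrightarrow> continuous_on UNIV (\<rho> \<gamma>)"
    and "\<And>x \<gamma>. disjoint_seq x \<Longrightarrow> range x \<subseteq> A \<Longrightarrow> \<gamma> \<in> \<Gamma> \<Longrightarrow> (\<lambda>n. \<rho> \<gamma> (T (x n))) \<longlonglongrightarrow> 0"
  shows "\<forall>\<epsilon>>0. \<forall>\<gamma>\<in>\<Gamma>. \<exists>u. 0 \<le> u \<and> u \<in> order_ideal hull A \<and>
    (\<forall>x\<in>A. \<rho> \<gamma> (T (pprt (\<bar>x\<bar> - u))) < \<epsilon>)"
proof (intro allI impI ballI, rule ccontr)
  fix \<epsilon> :: real and \<gamma>
  assume \<epsilon>: "0 < \<epsilon>" and \<gamma>: "\<gamma> \<in> \<Gamma>"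
  let ?I = "order_ideal hull A" and ?r = "\<rho> \<gamma>"
  assume "\<not> (\<exists>u. 0 \<le> u \<and> u \<in> ?I \<and> (\<forall>x\<in>A. ?r (T (pprt (\<bar>x\<bar> - u))) < \<epsilon>))"
  then have "\<forall>u. \<exists>x. 0 \<le> u \<and> u \<in> ?I \<longrightarrow> x \<in> A \<and> \<epsilon> \<le> ?r (T (pprt (\<bar>x\<bar> - u)))"
    by (meson not_less)
  then obtain f where f: "\<And>u. 0 \<le> u \<Longrightarrow> u \<in> ?I \<Longrightarrow> f u \<in> A"
    and f_large: "\<And>u. 0 \<le> u \<Longrightarrow> u \<in> ?I \<Longrightarrow> \<epsilon> \<le> ?r (T (pprt (\<bar>f u\<bar> - u)))"
    by metis
  have I: "subspace ?I" "solid ?I"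
    using order_ideal_hull[of A] by (auto simp: order_ideal_def)
  have abs_I: "\<bar>x\<bar> \<in> ?I" if "x \<in> A" for x
    using I(2) hull_inc[OF that, of order_ideal] unfolding solid_def
    by (metis abs_idempotent order_refl)

  \<comment> \<open>\<open>s n\<close> is the sum of the moduli of the first \<open>n\<close> chosen elements.\<close>
  define s where "s = rec_nat 0 (\<lambda>n r. r + \<bar>f (4^n *\<^sub>R r)\<bar>)"
  define x where "x n = f (4^n *\<^sub>R s n)" for n
  have s_0: "s 0 = 0" and s_Suc: "s (Suc n) = s n + \<bar>x n\<bar>" for n
    by (simp_all add: s_def x_def)
  have s: "0 \<le> s n \<and> s n \<in> ?I" for n
  proof (induction n)
    case 0
    show ?case using I(1) by (simp add: s_0 subspace_0)
  next
    case (Suc n)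
    then have "x n \<in> A"
      unfolding x_def using I(1) by (intro f) (auto simp: subspace_scale scaleR_nonneg_nonneg)
    then show ?case
      using Suc I(1) abs_I by (simp add: s_Suc subspace_add)
  qed
  have s4: "0 \<le> 4^n *\<^sub>R s n" "4^n *\<^sub>R s n \<in> ?I" for n
    using s[of n] I(1) by (auto simp: subspace_scale scaleR_nonneg_nonneg)
  have x: "x n \<in> A" for n
    unfolding x_def by (intro f s4)
  have s_ge: "\<bar>x n\<bar> \<le> s m" if "n < m" for n m
  proof -
    have "mono s"
      by (intro incseq_SucI) (simp add: s_Suc)
    then have "s (Suc n) \<le> s m"
      using that by (intro monoD[OF \<open>mono s\<close>]) simp
    moreover have "\<bar>x n\<bar> \<le> s (Suc n)"
      using s[of n] by (simp add: s_Suc)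
    ultimately show ?thesis by (rule order_trans[rotated])
  qed

  define y where "y = (\<Sum>n. (1/2)^n *\<^sub>R \<bar>x n\<bar>)"
  obtain B where B: "\<And>z. z \<in> A \<Longrightarrow> norm z \<le> B"
    using \<open>bounded A\<close> unfolding bounded_iff by blast
  have "summable (\<lambda>n. (1/2)^n *\<^sub>R \<bar>x n\<bar>)"
  proof (rule summable_comparison_test')
    show "summable (\<lambda>n. (1/2)^n * B)"
      by (intro summable_mult2 summable_geometric) simp
    show "norm ((1/2)^n *\<^sub>R \<bar>x n\<bar>) \<le> (1/2)^n * B" for n
      using B[OF x[of n]] by (simp add: norm_abs_banach_lattice divide_right_mono)
  qed
  then have y: "(1/2)^n *\<^sub>R \<bar>x n\<bar> \<le> y" for n
    unfolding y_def by (rule suminf_ge_term) (simp add: scaleR_nonneg_nonneg)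
  have y_nonneg: "0 \<le> y"
    using y[of 0] by (rule order_trans[rotated]) simp

  define w where "w n = pprt (\<bar>x n\<bar> - 4^n *\<^sub>R s n)" for n
  define v where "v n = pprt (\<bar>x n\<bar> - 4^n *\<^sub>R s n - (1/2)^n *\<^sub>R y)" for n
  have "disjoint_seq v"
    unfolding v_def by (intro disjoint_seq_truncations) (auto simp: s s_ge y)
  moreover have "v n \<in> A" for n
  proof -
    have "0 \<le> 4^n *\<^sub>R s n + (1/2)^n *\<^sub>R y"
      using s4(1)[of n] y_nonneg by (simp add: scaleR_nonneg_nonneg)
    from diff_left_mono[OF this, of "\<bar>x n\<bar>"] have "\<bar>v n\<bar> \<le> \<bar>x n\<bar>"
      by (simp add: v_def pprt_def diff_diff_eq del: diff_le_eq)
    then show ?thesis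
      using \<open>solid A\<close> x unfolding solid_def by blast
  qed
  ultimately have v_lim: "(\<lambda>n. ?r (T (v n))) \<longlonglongrightarrow> 0"
    using assms(6) \<gamma> by blast

  have "(\<lambda>n. w n - v n) \<longlonglongrightarrow> 0"
  proof (rule tendsto_norm_zero_cancel, rule tendsto_sandwich[OF _ _ tendsto_const])
    show "(\<lambda>n. (1/2)^n * norm y) \<longlonglongrightarrow> 0"
      by (intro tendsto_mult_left_zero LIMSEQ_power_zero) simp
    have "norm (w n - v n) \<le> (1/2)^n * norm y" for n
      using norm_pprt_diff_truncation_le[of "(1/2)^n *\<^sub>R y" "\<bar>x n\<bar> - 4^n *\<^sub>R s n"] y_nonneg
      by (simp add: w_def v_def scaleR_nonneg_nonneg)
    then show "\<forall>\<^sub>F n in sequentially. norm (w n - v n) \<le> (1/2)^n * norm y"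
      by simp
  qed simp
  then have "(\<lambda>n. T (w n - v n)) \<longlonglongrightarrow> T 0"
    by (rule bounded_linear.tendsto[OF \<open>bounded_linear T\<close>])
  then have "(\<lambda>n. ?r (T (w n - v n))) \<longlonglongrightarrow> ?r (T 0)"
    by (intro continuous_on_tendsto_compose[OF assms(5)[OF \<gamma>]]) auto
  moreover have "?r (T 0) = 0"
    using riesz_pseudonorm_zero[OF assms(4)[OF \<gamma>]]
    by (simp add: linear_0 bounded_linear.linear[OF \<open>bounded_linear T\<close>])
  ultimately have lim: "(\<lambda>n. ?r (T (v n)) + ?r (T (w n - v n))) \<longlonglongrightarrow> 0"
    using tendsto_add[OF v_lim] by fastforce
  have "\<epsilon> \<le> ?r (T (v n)) + ?r (T (w n - v n))" for n
  proof -
    have "\<epsilon> \<le> ?r (T (w n))"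
      using f_large[OF s4, of n] by (simp add: w_def x_def)
    also have "T (w n) = T (v n) + T (w n - v n)"
      by (simp add: linear_diff bounded_linear.linear[OF \<open>bounded_linear T\<close>])
    also have "?r \<dots> \<le> ?r (T (v n)) + ?r (T (w n - v n))"
      using assms(4)[OF \<gamma>] unfolding riesz_pseudonorm_def by blast
    finally show ?thesis .
  qed
  then have "\<epsilon> \<le> 0"
    by (intro LIMSEQ_le_const[OF lim]) auto
  then show False
    using \<epsilon> by simp
qed

end
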